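(* Let $H_1,H_2$ be infinite-dimensional complex Hilbert spaces, let $T:D(T)\subseteq H_1\to H_2$ be a densely defined closed linear operator that is onto $H_2$, and let $S:H_1\to H_2$ be a bounded linear operator such that, for some real $\lambda_1<1$, $$\|Sx\|\le\lambda_1\|Tx\|\quad\text{for all }x\in D(T).$$ Then: (1) $\|ST^\dagger\|<1$ and $(I+ST^\dagger)^{-1}$ is a bounded operator on $H_2$. In this case, $$\|(I+ST^\dagger)^{-1}\|\le\frac{1}{1-\|ST^\dagger\|}.$$ (2) $\|(S+T)^\dagger-T^\dagger\|\le\dfrac{\|T^\dagger\|^2\|S\|}{1-\|ST^\dagger\|}.$
   Context: $D(\cdot)$, $N(\cdot)$, $R(\cdot)$ denote the domain, null space and range of an operator, and $I$ denotes the identity operator. The sum $S+T$ has domain $D(T)$. For a densely defined closed operator $T:D(T)\subseteq H_1\to H_2$, the Moore-Penrose inverse $T^\dagger$ is the unique densely defined closed operator from $H_2$ to $H_1$ with domain $D(T^\dagger)=R(T)\oplus^\perp R(T)^\perp$ such that $TT^\dagger y=P_{\overline{R(T)}}\,y$ for all $y\in D(T^\dagger)$, $T^\dagger Tx=P_{N(T)^\perp}x$ for all $x\in D(T)$, and $N(T^\dagger)=R(T)^\perp$; here $P_M$ is the orthogonal projection onto the closed subspace $M$. When $R(T)$ is closed, $T^\dagger$ is bounded and defined on all of $H_2$. *)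

theory Defs
  imports "HOL-Analysis.Analysis"
begin

section \<open>Complex Hilbert spaces\<close>

text \<open>
  The inner product is linear in the first argument. Positivity and definiteness follow from
  \<open>cinner_self\<close>, which says that the norm is the one induced by the inner product.
\<close>

class complex_inner_space = real_normed_vector +
  fixes scaleC :: "complex \<Rightarrow> 'a \<Rightarrow> 'a"  (infixr "*\<^sub>C" 75)
    and cinner :: "'a \<Rightarrow> 'a \<Rightarrow> complex"
  assumes scaleC_add_right: "c *\<^sub>C (x + y) = c *\<^sub>C x + c *\<^sub>C y"
    and scaleC_add_left: "(c + d) *\<^sub>C x = c *\<^sub>C x + d *\<^sub>C x"
    and scaleC_scaleC: "c *\<^sub>C (d *\<^sub>C x) = (c * d) *\<^sub>C x"
    and scaleC_of_real: "complex_of_real r *\<^sub>C x = r *\<^sub>R x"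
    and cinner_commute: "cinner x y = cnj (cinner y x)"
    and cinner_add_left: "cinner (x + y) z = cinner x z + cinner y z"
    and cinner_scaleC_left: "cinner (c *\<^sub>C x) y = c * cinner x y"
    and cinner_self: "cinner x x = complex_of_real ((norm x)\<^sup>2)"

lemma vector_space_scaleC:
  "vector_space (scaleC :: complex \<Rightarrow> 'a \<Rightarrow> 'a::complex_inner_space)"
proof
  show "1 *\<^sub>C x = x" for x :: 'a
    using scaleC_of_real[of 1 x] by simp
qed (simp_all add: scaleC_add_right scaleC_add_left scaleC_scaleC)

class complex_hilbert_space = complex_inner_space + complete_space

definition infinite_dimensional :: "'a::complex_hilbert_space itself \<Rightarrow> bool" where
  "infinite_dimensional _ \<longleftrightarrow>
     \<not> (\<exists>B :: 'a set. finite B \<and> module.span scaleC B = UNIV)"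

definition orth_compl :: "'a::complex_hilbert_space set \<Rightarrow> 'a set" where
  "orth_compl M = {x. \<forall>y\<in>M. cinner x y = 0}"

text \<open>Meaningful for closed complex subspaces \<open>M\<close>.\<close>

definition orth_proj :: "'a::complex_hilbert_space set \<Rightarrow> 'a \<Rightarrow> 'a" where
  "orth_proj M x = (THE p. p \<in> M \<and> x - p \<in> orth_compl M)"


section \<open>Unbounded and bounded operators\<close>

text \<open>
  An operator \<open>T : D(T) \<subseteq> H\<^sub>1 \<rightarrow> H\<^sub>2\<close> is a partial map: its domain is \<^term>\<open>dom T\<close>, its range
  \<^term>\<open>ran T\<close>, and composition on the natural domain is \<^term>\<open>map_comp\<close>.
\<close>

definition op_apply :: "('a \<rightharpoonup> 'b) \<Rightarrow> 'a \<Rightarrow> 'b" where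
  "op_apply T x = the (T x)"

definition linear_operator ::
    "('a::complex_hilbert_space \<rightharpoonup> 'b::complex_hilbert_space) \<Rightarrow> bool" where
  "linear_operator T \<longleftrightarrow>
     module.subspace scaleC (dom T) \<and>
     (\<forall>x\<in>dom T. \<forall>y\<in>dom T. op_apply T (x + y) = op_apply T x + op_apply T y) \<and>
     (\<forall>c. \<forall>x\<in>dom T. op_apply T (c *\<^sub>C x) = c *\<^sub>C op_apply T x)"

definition closed_densely_defined ::
    "('a::complex_hilbert_space \<rightharpoonup> 'b::complex_hilbert_space) \<Rightarrow> bool" where
  "closed_densely_defined T \<longleftrightarrow>
     linear_operator T \<and> closure (dom T) = UNIV \<and> closed (Map.graph T)"

definition null_space ::
    "('a::complex_hilbert_space \<rightharpoonup> 'b::complex_hilbert_space) \<Rightarrow> 'a set" where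
  "null_space T = {x. T x = Some 0}"

definition bounded_clinear ::
    "('a::complex_hilbert_space \<Rightarrow> 'b::complex_hilbert_space) \<Rightarrow> bool" where
  "bounded_clinear f \<longleftrightarrow>
     Vector_Spaces.linear scaleC scaleC f \<and> (\<exists>K. \<forall>x. norm (f x) \<le> K * norm x)"

definition everywhere_bounded ::
    "('a::complex_hilbert_space \<rightharpoonup> 'b::complex_hilbert_space) \<Rightarrow> bool" where
  "everywhere_bounded A \<longleftrightarrow> dom A = UNIV \<and> bounded_clinear (op_apply A)"

text \<open>The sum \<open>S + T\<close> of an everywhere defined \<open>S\<close> and a partial \<open>T\<close>, with domain \<^term>\<open>dom T\<close>.\<close>

definition add_operator ::
    "('a::complex_hilbert_space \<Rightarrow> 'b::complex_hilbert_space) \<Rightarrow> ('a \<rightharpoonup> 'b) \<Rightarrow> ('a \<rightharpoonup> 'b)" where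
  "add_operator S T = (\<lambda>x. map_option (\<lambda>y. S x + y) (T x))"


section \<open>The Moore-Penrose inverse\<close>

definition is_mp_inverse ::
    "('a::complex_hilbert_space \<rightharpoonup> 'b::complex_hilbert_space) \<Rightarrow> ('b \<rightharpoonup> 'a) \<Rightarrow> bool" where
  "is_mp_inverse T X \<longleftrightarrow>
     closed_densely_defined X \<and>
     dom X = {u + v | u v. u \<in> ran T \<and> v \<in> orth_compl (ran T)} \<and>
     (\<forall>y\<in>dom X. (T \<circ>\<^sub>m X) y = Some (orth_proj (closure (ran T)) y)) \<and>
     (\<forall>x\<in>dom T. (X \<circ>\<^sub>m T) x = Some (orth_proj (orth_compl (null_space T)) x)) \<and>
     null_space X = orth_compl (ran T)"

text \<open>Meaningful when \<^term>\<open>closed_densely_defined T\<close>; such an inverse then exists uniquely.\<close>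

definition mp_inverse ::
    "('a::complex_hilbert_space \<rightharpoonup> 'b::complex_hilbert_space) \<Rightarrow> ('b \<rightharpoonup> 'a)" where
  "mp_inverse T = (THE X. is_mp_inverse T X)"

end

theory Submission
  imports Defs
begin

text \<open>
  Since \<open>T\<close> is onto, \<open>T\<^sup>\<dagger> y\<close> is the solution of \<open>T x = y\<close> in \<open>N(T)\<^sup>\<bottom>\<close>; it is everywhere defined with
  closed graph, hence bounded by the closed graph theorem, which rests on Baire's theorem. The
  hypothesis gives \<open>\<parallel>S T\<^sup>\<dagger> y\<parallel> \<le> \<lambda>\<^sub>1 \<parallel>y\<parallel>\<close>, so \<open>I + S T\<^sup>\<dagger>\<close> is invertible by Banach's fixed point theorem.
  Because \<open>\<lambda>\<^sub>1 < 1\<close>, the operators \<open>S + T\<close> and \<open>T\<close> have the same null space, and \<open>S + T\<close> maps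
  \<open>T\<^sup>\<dagger> z\<close> to \<open>(I + S T\<^sup>\<dagger>) z\<close>. Therefore \<open>(S + T)\<^sup>\<dagger> = T\<^sup>\<dagger> (I + S T\<^sup>\<dagger>)\<^sup>-\<^sup>1\<close> and
  \<open>(S + T)\<^sup>\<dagger> - T\<^sup>\<dagger> = - T\<^sup>\<dagger> S T\<^sup>\<dagger> (I + S T\<^sup>\<dagger>)\<^sup>-\<^sup>1\<close>, from which the estimate is read off.
\<close>

section \<open>The closed graph theorem\<close>

subclass (in complex_hilbert_space) banach ..

text \<open>The closed sets \<open>A n\<close> cover the space, so by Baire one of them contains a
  ball. Any small vector is a difference of two points of that ball, both approximable by vectors
  with image of norm at most \<open>n\<close>; homogeneity transfers this to every
  \<open>x\<close>.\<close>

lemma closed_graph_imp_approx: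
  fixes f :: "'a::banach \<Rightarrow> 'b::real_normed_vector"
  assumes "linear f"
  shows "\<exists>K\<ge>0. \<forall>x. \<exists>x'. norm (f x') \<le> K * norm x \<and> norm (x - x') \<le> norm x / 2"
proof -
  interpret f: linear f by fact
  define A where "A n = closure {x. norm (f x) \<le> real n}" for n
  have "\<exists>n. interior (A n) \<noteq> {}"
  proof (rule ccontr)
    assume "\<not> ?thesis"
    then have 1: "euclidean interior_of \<Union>(range A) = {}"
      by (intro Baire_category_alt) (auto simp: A_def completely_metrizable_space_euclidean)
    have "x \<in> \<Union>(range A)" for x
    proof -
      obtain n where "norm (f x) \<le> real n" using real_arch_simple by blast
      then have "x \<in> A n" unfolding A_def by (intro subsetD[OF closure_subset]) simp
      then show ?thesis by blast
    qed
    then have "\<Union>(range A) = UNIV" by blast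
    with 1 show False by simp
  qed
  then obtain n y where "y \<in> interior (A n)" by blast
  then obtain r where r: "r > 0" "ball y r \<subseteq> A n" by (auto simp: mem_interior)
  have near: "\<exists>u. norm (f u) \<le> real n \<and> dist u z < r / 8" if "z \<in> ball y r" for z
  proof -
    have "z \<in> closure {x. norm (f x) \<le> real n}" using r that by (auto simp: A_def)
    moreover have "r / 8 > 0" using r by simp
    ultimately show ?thesis using closure_approachableD
      by (force simp: dist_commute simp del: less_divide_eq_numeral1)
  qed
  have "\<exists>x'. norm (f x') \<le> 4 * real n / r * norm x \<and> norm (x - x') \<le> norm x / 2" for x
  proof (cases "x = 0")
    case True
    show ?thesis by (rule exI[of _ 0]) (simp add: True f.zero)
  next
    case False
    \<comment> \<open>Dividing by \<open>t\<close> shrinks \<open>x\<close> to length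
      \<open>r / 2\<close>, so \<open>y + x / t\<close> stays in the ball. The two errors of
      \<open>r / 8\<close> scale back to \<open>t * r / 4 = norm x / 2\<close>.\<close>
    define t where "t = 2 * norm x / r"
    have t: "t > 0" using r False by (simp add: t_def)
    have "norm ((1 / t) *\<^sub>R x) = r / 2" using r False by (simp add: t_def)
    then have "y + (1 / t) *\<^sub>R x \<in> ball y r" "y \<in> ball y r" using r by (simp_all add: dist_norm)
    then obtain u v where u: "norm (f u) \<le> real n" "dist u (y + (1 / t) *\<^sub>R x) < r / 8"
      and v: "norm (f v) \<le> real n" "dist v y < r / 8" using near by meson
    define x' where "x' = t *\<^sub>R (u - v)"
    have "norm (f u - f v) \<le> real n + real n"
      using norm_triangle_ineq4[of "f u" "f v"] u(1) v(1) by linarith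
    then have "t * norm (f u - f v) \<le> t * (real n + real n)"
      using t by (intro mult_left_mono) simp_all
    also have "\<dots> = 4 * real n / r * norm x" by (simp add: t_def)
    finally have 1: "norm (f x') \<le> 4 * real n / r * norm x"
      using t by (simp add: x'_def f.scale f.diff)
    have "x - x' = t *\<^sub>R ((v - y) - (u - (y + (1 / t) *\<^sub>R x)))"
      using t by (simp add: x'_def algebra_simps)
    then have "norm (x - x') = t * norm ((v - y) - (u - (y + (1 / t) *\<^sub>R x)))"
      using t by (simp only: norm_scaleR abs_of_pos)
    also have "norm ((v - y) - (u - (y + (1 / t) *\<^sub>R x))) \<le> r / 8 + r / 8"
      using norm_triangle_ineq4[of "v - y" "u - (y + (1 / t) *\<^sub>R x)"] u(2) v(2)
      unfolding dist_norm by linarith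
    then have "t * norm ((v - y) - (u - (y + (1 / t) *\<^sub>R x))) \<le> t * (r / 8 + r / 8)"
      using t by (intro mult_left_mono) simp_all
    also have "\<dots> = norm x / 2" using r by (simp add: t_def)
    finally show ?thesis using 1 by blast
  qed
  moreover have "4 * real n / r \<ge> 0" using r by simp
  ultimately show ?thesis by blast
qed

text \<open>
  The approximations of the previous lemma are iterated on the error: they expand \<open>x\<close> as a series
  whose image under \<open>f\<close> converges absolutely, and closedness identifies the sum of the images
  with \<open>f x\<close>.
\<close>

theorem closed_graph:
  fixes f :: "'a::banach \<Rightarrow> 'b::banach"
  assumes lin: "linear f" and cl: "closed (range (\<lambda>x. (x, f x)))"
  shows "bounded_linear f"
proof -
  interpret f: linear f by fact
  obtain K g where K: "K \<ge> 0" and g: "\<And>x. norm (f (g x)) \<le> K * norm x"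
    "\<And>x. norm (x - g x) \<le> norm x / 2"
    using closed_graph_imp_approx[OF lin] by metis
  have "norm (f x) \<le> norm x * (2 * K)" for x
  proof -
    \<comment> \<open>\<open>e k\<close> is what remains of \<open>x\<close> after \<open>k\<close>
      approximations, so the sums of \<open>g (e k)\<close> telescope. The remainder halves each
      time, which makes the images summable with total at most
      \<open>2 * K * norm x\<close>.\<close>
    define e where "e = rec_nat x (\<lambda>_ z. z - g z)"
    have e: "e 0 = x" "e (Suc k) = e k - g (e k)" for k by (auto simp: e_def)
    have ne: "norm (e k) \<le> norm x * (1/2) ^ k" for k
    proof (induction k)
      case (Suc k)
      then show ?case using g(2)[of "e k"] by (simp add: e)
    qed (simp add: e)
    have nf: "norm (f (g (e k))) \<le> K * norm x * (1/2) ^ k" for k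
      using g(1)[of "e k"] mult_left_mono[OF ne[of k] K] by simp
    have geo: "(\<lambda>k. K * norm x * (1/2) ^ k) sums (K * norm x * 2)"
      using sums_mult[OF geometric_sums[of "1/2::real"]] by simp
    then have summ: "summable (\<lambda>k. f (g (e k)))"
      by (intro summable_comparison_test'[OF sums_summable nf])
    have part: "(\<Sum>k<n. g (e k)) = x - e n" for n
      by (induction n) (auto simp: e)
    have "(\<lambda>k. norm x * (1/2) ^ k) \<longlonglongrightarrow> 0"
      by (intro tendsto_mult_right_zero LIMSEQ_power_zero) simp
    with ne have "e \<longlonglongrightarrow> 0"
      by (intro Lim_null_comparison[of e] always_eventually allI)
    then have "(\<lambda>n. x - e n) \<longlonglongrightarrow> x"
      using tendsto_diff[OF tendsto_const[of x], of e 0] by simp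
    moreover have "(\<lambda>n. f (x - e n)) \<longlonglongrightarrow> (\<Sum>k. f (g (e k)))"
      using summable_LIMSEQ[OF summ] by (simp add: part[symmetric] f.sum)
    ultimately have lim: "(\<lambda>n. (x - e n, f (x - e n))) \<longlonglongrightarrow> (x, \<Sum>k. f (g (e k)))"
      by (rule tendsto_Pair)
    have "(x, \<Sum>k. f (g (e k))) \<in> range (\<lambda>x. (x, f x))"
      by (rule closed_sequentially[OF cl _ lim]) (rule rangeI)
    then have "f x = (\<Sum>k. f (g (e k)))" by auto
    also have "norm \<dots> \<le> K * norm x * 2"
      using norm_suminf_le[OF nf sums_summable[OF geo]] sums_unique[OF geo] by simp
    finally show ?thesis by (simp add: mult_ac)
  qed
  with lin show ?thesis by (auto simp: bounded_linear_def bounded_linear_axioms_def)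
qed


section \<open>Orthogonal projections\<close>

interpretation complex_vector: vector_space "scaleC :: complex \<Rightarrow> 'a \<Rightarrow> 'a::complex_inner_space"
  by (rule vector_space_scaleC)

section \<open>Identities for the inner product and its norm\<close>

context complex_inner_space
begin

lemma cinner_add_right: "cinner x (y + z) = cinner x y + cinner x z"
  by (metis cinner_commute cinner_add_left complex_cnj_add)

lemma cinner_scaleC_right: "cinner x (c *\<^sub>C y) = cnj c * cinner x y"
  by (metis cinner_commute cinner_scaleC_left complex_cnj_mult)

lemma cinner_zero_left [simp]: "cinner 0 x = 0"
  using cinner_add_left[of 0 0 x] by simp

lemma cinner_zero_right [simp]: "cinner x 0 = 0"
  using cinner_add_right[of x 0 0] by simp

lemma cinner_diff_left: "cinner (x - y) z = cinner x z - cinner y z"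
  using cinner_add_left[of "x - y" y z] by simp

lemma cinner_diff_right: "cinner x (y - z) = cinner x y - cinner x z"
  using cinner_add_right[of x "y - z" z] by simp

lemma cinner_eq_0_commute: "cinner x y = 0 \<longleftrightarrow> cinner y x = 0"
  by (metis cinner_commute complex_cnj_zero)

lemma cinner_self_eq_0 [simp]: "cinner x x = 0 \<longleftrightarrow> x = 0"
  by (simp add: cinner_self)

text \<open>Used to test minimality of the norm of \<open>x\<close> along the direction
  \<open>y\<close>; the factor \<open>cinner x y\<close> supplies the right phase, so only a real
  \<open>t\<close> remains to be chosen.\<close>

lemma norm_diff_scaleC_cinner:
  fixes t :: real
  shows "(norm (x - (t * cinner x y) *\<^sub>C y))\<^sup>2
    = (norm x)\<^sup>2 - (2 * t - t\<^sup>2 * (norm y)\<^sup>2) * (norm (cinner x y))\<^sup>2"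
proof -
  have n: "cinner x y * cnj (cinner x y) = complex_of_real ((norm (cinner x y))\<^sup>2)"
    by (rule complex_norm_square[symmetric])
  have "complex_of_real ((norm (x - (t * cinner x y) *\<^sub>C y))\<^sup>2)
    = cinner x x - cinner x y * cnj (cinner x y) * t - t * cinner x y * cinner y x
      + t * t * (cinner x y * cnj (cinner x y)) * cinner y y"
    unfolding cinner_self[symmetric]
    by (simp add: cinner_diff_left cinner_diff_right cinner_scaleC_left cinner_scaleC_right
        algebra_simps)
  also have "cinner y x = cnj (cinner x y)" by (rule cinner_commute)
  also have "cinner x x - cinner x y * cnj (cinner x y) * t - t * cinner x y * cnj (cinner x y)
      + t * t * (cinner x y * cnj (cinner x y)) * cinner y y
    = complex_of_real ((norm x)\<^sup>2 - (2 * t - t\<^sup>2 * (norm y)\<^sup>2) * (norm (cinner x y))\<^sup>2)"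
    unfolding mult.assoc n cinner_self by (simp add: algebra_simps power2_eq_square)
  finally show ?thesis by (simp only: of_real_eq_iff)
qed

lemma parallelogram_law:
  "(norm (x + y))\<^sup>2 + (norm (x - y))\<^sup>2 = 2 * (norm x)\<^sup>2 + 2 * (norm y)\<^sup>2"
proof -
  have "complex_of_real ((norm (x + y))\<^sup>2 + (norm (x - y))\<^sup>2)
    = complex_of_real (2 * (norm x)\<^sup>2 + 2 * (norm y)\<^sup>2)"
    unfolding of_real_add of_real_mult cinner_self[symmetric]
    by (simp add: cinner_add_left cinner_add_right cinner_diff_left cinner_diff_right)
  then show ?thesis by (simp only: of_real_eq_iff)
qed

lemma norm_add_orthogonal:
  assumes "cinner x y = 0"
  shows "(norm (x + y))\<^sup>2 = (norm x)\<^sup>2 + (norm y)\<^sup>2"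
proof -
  have "cinner y x = 0" using assms cinner_eq_0_commute by blast
  with assms have "complex_of_real ((norm (x + y))\<^sup>2) = complex_of_real ((norm x)\<^sup>2 + (norm y)\<^sup>2)"
    unfolding of_real_add cinner_self[symmetric] by (simp add: cinner_add_left cinner_add_right)
  then show ?thesis by (simp only: of_real_eq_iff)
qed

end

text \<open>Orthogonality becomes minimality of a norm: one direction is Pythagoras, the other
  compares \<open>x\<close> with \<open>x\<close> minus its projection onto the line of
  \<open>m\<close>. This yields both closedness of complements and the projection theorem.\<close>

lemma mem_orth_compl_iff_norm_le:
  fixes M :: "'a::complex_hilbert_space set"
  assumes M: "complex_vector.subspace M"
  shows "x \<in> orth_compl M \<longleftrightarrow> (\<forall>m\<in>M. norm x \<le> norm (x - m))"
proof
  assume x: "x \<in> orth_compl M"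
  show "\<forall>m\<in>M. norm x \<le> norm (x - m)"
  proof
    fix m assume "m \<in> M"
    then have "cinner x (- m) = 0"
      using x M complex_vector.subspace_neg by (auto simp: orth_compl_def)
    from norm_add_orthogonal[OF this] have "(norm x)\<^sup>2 \<le> (norm (x - m))\<^sup>2" by simp
    then show "norm x \<le> norm (x - m)" by (rule power2_le_imp_le) simp
  qed
next
  assume le: "\<forall>m\<in>M. norm x \<le> norm (x - m)"
  have "cinner x m = 0" if "m \<in> M" for m
  proof (cases "m = 0")
    case False
    \<comment> \<open>This value maximises \<open>2 * t - t^2 * (norm m)^2\<close>, the maximum
      being \<open>t\<close> itself.\<close>
    define t where "t = 1 / (norm m)\<^sup>2"
    have t: "t > 0" "t\<^sup>2 * (norm m)\<^sup>2 = t"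
      using False by (simp_all add: t_def power2_eq_square)
    have "norm x \<le> norm (x - (t * cinner x m) *\<^sub>C m)"
      using le that M complex_vector.subspace_scale by blast
    then have "(norm x)\<^sup>2 \<le> (norm (x - (t * cinner x m) *\<^sub>C m))\<^sup>2" by (simp add: power_mono)
    then have "t * (norm (cinner x m))\<^sup>2 \<le> 0"
      unfolding norm_diff_scaleC_cinner t(2) by simp
    then show ?thesis using t(1) by (simp add: mult_le_0_iff)
  qed simp
  then show "x \<in> orth_compl M" by (simp add: orth_compl_def)
qed

lemma closed_orth_compl:
  assumes "complex_vector.subspace M"
  shows "closed (orth_compl M)"
proof -
  have "orth_compl M = (\<Inter>m\<in>M. {x. norm x \<le> norm (x - m)})"
    using mem_orth_compl_iff_norm_le[OF assms] by blast
  then show ?thesis by (auto intro!: closed_Collect_le continuous_intros)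
qed

lemma subspace_orth_compl: "complex_vector.subspace (orth_compl M)"
  unfolding complex_vector.subspace_def
  by (auto simp: orth_compl_def cinner_add_left cinner_scaleC_left)

lemma mem_orth_compl_self: "x \<in> M \<Longrightarrow> x \<in> orth_compl M \<Longrightarrow> x = 0"
  by (auto simp: orth_compl_def)

lemma subset_orth_compl_orth_compl: "M \<subseteq> orth_compl (orth_compl M)"
  by (auto simp: orth_compl_def cinner_eq_0_commute)

lemma orth_compl_UNIV: "orth_compl UNIV = {0}"
  using mem_orth_compl_self[of _ UNIV] by (auto simp: orth_compl_def)

text \<open>Two candidates differ by a vector lying both in \<open>M\<close> and in its complement,
  which must be zero; hence the definite description picks \<open>p\<close>.\<close>

lemma orth_proj_eqI:
  assumes "complex_vector.subspace M" "p \<in> M" "x - p \<in> orth_compl M"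
  shows "orth_proj M x = p"
  unfolding orth_proj_def
proof (rule the_equality)
  fix q assume q: "q \<in> M \<and> x - q \<in> orth_compl M"
  then have "p - q \<in> M" using assms complex_vector.subspace_diff by blast
  moreover have "(x - q) - (x - p) \<in> orth_compl M"
    using q assms complex_vector.subspace_diff[OF subspace_orth_compl] by blast
  ultimately show "q = p" using mem_orth_compl_self[of "p - q" M] by simp
qed (use assms in blast)

text \<open>A minimizing sequence is Cauchy by the parallelogram law; completeness provides its
  limit and closedness keeps the limit in \<open>M\<close>.\<close>

lemma closest_point_exists:
  fixes M :: "'a::complex_hilbert_space set"
  assumes M: "complex_vector.subspace M" "closed M"
  shows "\<exists>p\<in>M. \<forall>m\<in>M. norm (x - p) \<le> norm (x - m)"
proof -
  define d where "d = (INF m\<in>M. norm (x - m))"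
  have ne: "M \<noteq> {}" using M(1) complex_vector.subspace_0 by blast
  have bdd: "bdd_below ((\<lambda>m. norm (x - m)) ` M)" by (rule bdd_belowI2[of _ 0]) simp
  have d: "d \<le> norm (x - m)" if "m \<in> M" for m
    unfolding d_def by (rule cINF_lower[OF bdd that])
  have d0: "d \<ge> 0" unfolding d_def using ne by (intro cINF_greatest) auto
  have "\<exists>m\<in>M. norm (x - m) < d + 1 / Suc n" for n
    using cINF_less_iff[OF ne bdd, of "d + 1 / Suc n"] by (simp add: d_def)
  then obtain m where m: "\<And>n. m n \<in> M" "\<And>n. norm (x - m n) < d + 1 / Suc n" by metis
  have "(\<lambda>n. d + 1 / Suc n) \<longlonglongrightarrow> d + 0"
    by (intro tendsto_add tendsto_const LIMSEQ_Suc[OF lim_1_over_n])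
  then have up: "(\<lambda>n. d + 1 / Suc n) \<longlonglongrightarrow> d" by simp
  have lim: "(\<lambda>n. norm (x - m n)) \<longlonglongrightarrow> d"
    by (rule tendsto_sandwich[OF always_eventually always_eventually tendsto_const up])
      (use d m in \<open>blast intro: less_imp_le\<close>)+
  \<comment> \<open>The midpoint of \<open>m i\<close> and \<open>m j\<close> lies in
    \<open>M\<close>, so its distance from \<open>x\<close> is at least \<open>d\<close>; this
    bounds the sum term of the parallelogram law from below.\<close>
  have diam: "(norm (m i - m j))\<^sup>2 \<le> 2 * ((norm (x - m i))\<^sup>2 - d\<^sup>2) + 2 * ((norm (x - m j))\<^sup>2 - d\<^sup>2)"
    for i j
  proof -
    have "complex_of_real (1/2) *\<^sub>C (m i + m j) \<in> M"
      using m(1) M(1) complex_vector.subspace_scale complex_vector.subspace_add by blast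
    then have "d \<le> norm (x - (1/2) *\<^sub>R (m i + m j))"
      unfolding scaleC_of_real by (rule d)
    also have "x - (1/2) *\<^sub>R (m i + m j) = (1/2) *\<^sub>R ((x - m i) + (x - m j))"
      using scaleR_half_double[of x] by (simp add: algebra_simps)
    finally have "2 * d \<le> norm ((x - m i) + (x - m j))" by simp
    then have "(2 * d)\<^sup>2 \<le> (norm ((x - m i) + (x - m j)))\<^sup>2" using d0 by (intro power_mono) auto
    then show ?thesis using parallelogram_law[of "x - m i" "x - m j"]
      by (simp add: power_mult_distrib norm_minus_commute)
  qed
  have "Cauchy m"
  proof (rule CauchyI)
    fix e :: real assume "e > 0"
    have "(\<lambda>n. (norm (x - m n))\<^sup>2 - d\<^sup>2) \<longlonglongrightarrow> d\<^sup>2 - d\<^sup>2" by (intro tendsto_intros lim)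
    \<comment> \<open>With \<open>e^2 / 4\<close> for each index, the two doubled terms in
      \<open>diam\<close> add up to less than \<open>e^2\<close>.\<close>
    then have "eventually (\<lambda>n. (norm (x - m n))\<^sup>2 - d\<^sup>2 < e\<^sup>2 / 4) sequentially"
      using \<open>e > 0\<close> by (intro order_tendstoD(2)) auto
    then obtain N where N: "\<And>n. n \<ge> N \<Longrightarrow> (norm (x - m n))\<^sup>2 - d\<^sup>2 < e\<^sup>2 / 4"
      by (auto simp: eventually_sequentially)
    have "norm (m i - m j) < e" if "i \<ge> N" "j \<ge> N" for i j
    proof -
      have "(norm (m i - m j))\<^sup>2 < e\<^sup>2" using diam[of i j] N[OF that(1)] N[OF that(2)]
        by (simp add: field_simps)
      then show ?thesis by (rule power2_less_imp_less) (use \<open>e > 0\<close> in simp)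
    qed
    then show "\<exists>N. \<forall>i\<ge>N. \<forall>j\<ge>N. norm (m i - m j) < e" by (intro exI[of _ N] allI impI)
  qed
  then obtain p where p: "m \<longlonglongrightarrow> p" using Cauchy_convergent convergent_def by blast
  have "p \<in> M" by (rule closed_sequentially[OF M(2) m(1) p])
  moreover have "(\<lambda>n. norm (x - m n)) \<longlonglongrightarrow> norm (x - p)" by (intro tendsto_intros p)
  then have "norm (x - p) = d" using lim LIMSEQ_unique by blast
  ultimately show ?thesis using d by auto
qed

text \<open>Translating by the closest point \<open>p\<close>, which stays inside \<open>M\<close>,
  turns its minimality into the norm criterion for \<open>x - p\<close>.\<close>

lemma orth_decomposition:
  fixes M :: "'a::complex_hilbert_space set"
  assumes M: "complex_vector.subspace M" "closed M"
  shows "\<exists>p\<in>M. x - p \<in> orth_compl M"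
proof -
  obtain p where p: "p \<in> M" "\<forall>m\<in>M. norm (x - p) \<le> norm (x - m)"
    using closest_point_exists[OF M] by blast
  have "norm (x - p) \<le> norm ((x - p) - m)" if "m \<in> M" for m
    using p(2) complex_vector.subspace_add[OF M(1) p(1) that] by (metis diff_diff_add)
  then show ?thesis using p(1) mem_orth_compl_iff_norm_le[OF M(1)] by blast
qed


section \<open>Perturbations of the identity\<close>

text \<open>Gives access to the theory of real bounded linear maps and \<open>onorm\<close>; real
  homogeneity is complex homogeneity at real scalars.\<close>

lemma bounded_clinear_iff:
  "bounded_clinear f \<longleftrightarrow>
     bounded_linear f \<and> (\<forall>c x. f (c *\<^sub>C x) = c *\<^sub>C f x)"
proof
  assume f: "bounded_clinear f"
  then have hom: "f (x + y) = f x + f y" "f (c *\<^sub>C x) = c *\<^sub>C f x" for x y c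
    unfolding bounded_clinear_def Vector_Spaces.linear_iff by blast+
  obtain K where "\<And>x. norm (f x) \<le> K * norm x"
    using f unfolding bounded_clinear_def by blast
  then have "bounded_linear f"
    using hom(1) hom(2)[of "complex_of_real _"]
    by (intro bounded_linear_intro[of f K]) (simp_all add: scaleC_of_real mult.commute)
  with hom(2) show "bounded_linear f \<and> (\<forall>c x. f (c *\<^sub>C x) = c *\<^sub>C f x)" by blast
next
  assume f: "bounded_linear f \<and> (\<forall>c x. f (c *\<^sub>C x) = c *\<^sub>C f x)"
  then obtain K where "\<And>x. norm (f x) \<le> norm x * K"
    using bounded_linear.bounded by blast
  then show "bounded_clinear f"
    unfolding bounded_clinear_def Vector_Spaces.linear_iff
    using f by (auto simp: vector_space_scaleC linear_simps(1) mult.commute intro!: exI[of _ K])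
qed

lemma bounded_clinear_compose:
  "bounded_clinear f \<Longrightarrow> bounded_clinear g \<Longrightarrow> bounded_clinear (f \<circ> g)"
  by (simp add: bounded_clinear_iff bounded_linear_compose o_def)

text \<open>The lower bound \<open>(1 - onorm B) * norm y\<close> for the norm of
  \<open>y + B y\<close> gives injectivity and the norm of the inverse. Surjectivity: a solution of
  \<open>x + B x = y\<close> is a fixed point of the contraction sending \<open>x\<close> to
  \<open>y - B x\<close>.\<close>

lemma bounded_linear_perturbation_identity:
  fixes B :: "'a::banach \<Rightarrow> 'a"
  assumes B: "bounded_linear B" "onorm B < 1"
  shows "bij (\<lambda>y. y + B y)"
    and "norm (inv (\<lambda>y. y + B y) y) \<le> 1 / (1 - onorm B) * norm y"
proof -
  interpret B: bounded_linear B by fact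
  let ?F = "\<lambda>y. y + B y"
  have low: "(1 - onorm B) * norm y \<le> norm (?F y)" for y
    using onorm[OF B(1), of y] norm_diff_ineq[of y "B y"] by (simp add: algebra_simps)
  have "inj ?F"
  proof (rule injI)
    fix x y assume "?F x = ?F y"
    then have "?F (x - y) = 0" by (simp add: B.diff algebra_simps)
    then have "(1 - onorm B) * norm (x - y) \<le> 0" using low[of "x - y"] by simp
    then show "x = y" using B(2) by (simp add: mult_le_0_iff)
  qed
  moreover have "\<exists>x. y = ?F x" for y
  proof -
    have "\<exists>!x. y - B x = x"
    proof (rule banach_fix_type[of "onorm B"])
      show "\<forall>u v. dist (y - B u) (y - B v) \<le> onorm B * dist u v"
      proof (intro allI)
        fix u v
        show "dist (y - B u) (y - B v) \<le> onorm B * dist u v"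
          using onorm[OF B(1), of "u - v"] by (simp add: dist_norm B.diff norm_minus_commute)
      qed
    qed (use B onorm_pos_le in auto)
    then obtain x where "y - B x = x" by blast
    then have "y = ?F x" by (simp add: algebra_simps)
    then show ?thesis ..
  qed
  ultimately show bij: "bij ?F" by (simp add: bij_def surj_def)
  have "(1 - onorm B) * norm (inv ?F y) \<le> norm y"
    using low[of "inv ?F y"] surj_f_inv_f[OF bij_is_surj[OF bij], of y] by simp
  then show "norm (inv ?F y) \<le> 1 / (1 - onorm B) * norm y"
    using B(2) by (simp add: field_simps)
qed

lemma bounded_clinear_inv_perturbation_identity:
  assumes B: "bounded_clinear B" "onorm B < 1"
  shows "bounded_clinear (inv (\<lambda>y. y + B y))"
proof -
  have bl: "bounded_linear B" and sc: "B (c *\<^sub>C x) = c *\<^sub>C B x" for c x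
    using B(1) by (simp_all add: bounded_clinear_iff)
  note bij = bounded_linear_perturbation_identity(1)[OF bl B(2)]
  let ?F = "\<lambda>y. y + B y"
  let ?G = "inv ?F"
  have FG: "?F (?G y) = y" for y by (rule surj_f_inv_f[OF bij_is_surj[OF bij]])
  have GI: "?F x = y \<Longrightarrow> ?G y = x" for x y
    using inv_f_f[OF bij_is_inj[OF bij], of x] by simp
  have add: "?G (x + y) = ?G x + ?G y" for x y
    using FG[of x] FG[of y] by (intro GI) (simp add: linear_simps(1)[OF bl] algebra_simps)
  have scC: "?G (c *\<^sub>C x) = c *\<^sub>C ?G x" for c x
    using FG[of x] by (intro GI) (simp add: sc flip: scaleC_add_right)
  have "bounded_linear ?G"
    using bounded_linear_perturbation_identity(2)[OF bl B(2)] scC[of "complex_of_real _"]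
    by (intro bounded_linear_intro[of ?G "1 / (1 - onorm B)"])
      (simp_all add: add scaleC_of_real mult.commute)
  with scC show ?thesis by (simp add: bounded_clinear_iff)
qed


section \<open>Moore-Penrose inverses of onto operators\<close>

lemma closed_densely_definedD:
  assumes "closed_densely_defined T"
  shows "linear_operator T" "closed (Map.graph T)"
  using assms by (simp_all add: closed_densely_defined_def)

text \<open>An equation \<open>T x = Some a\<close> records membership in the domain and the value
  together, so later proofs need no separate domain conditions.\<close>

lemma linear_operator_add:
  assumes "linear_operator T" "T x = Some a" "T y = Some b"
  shows "T (x + y) = Some (a + b)"
proof -
  have "x \<in> dom T" "y \<in> dom T" using assms by auto
  moreover from this have "x + y \<in> dom T"
    using assms(1) complex_vector.subspace_add unfolding linear_operator_def by blast
  then obtain c where "T (x + y) = Some c" by blast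
  moreover have "op_apply T (x + y) = op_apply T x + op_apply T y"
    using assms(1) calculation(1,2) unfolding linear_operator_def by blast
  ultimately show ?thesis using assms(2,3) by (simp add: op_apply_def)
qed

lemma linear_operator_scaleC:
  assumes "linear_operator T" "T x = Some a"
  shows "T (c *\<^sub>C x) = Some (c *\<^sub>C a)"
proof -
  have "x \<in> dom T" using assms by auto
  moreover from this have "c *\<^sub>C x \<in> dom T"
    using assms(1) complex_vector.subspace_scale unfolding linear_operator_def by blast
  then obtain b where "T (c *\<^sub>C x) = Some b" by blast
  moreover have "op_apply T (c *\<^sub>C x) = c *\<^sub>C op_apply T x"
    using assms(1) calculation(1) unfolding linear_operator_def by blast
  ultimately show ?thesis using assms(2) by (simp add: op_apply_def)
qed

lemma linear_operator_diff:
  assumes "linear_operator T" "T x = Some a" "T y = Some b"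
  shows "T (x - y) = Some (a - b)"
  using linear_operator_add[OF assms(1,2) linear_operator_scaleC[OF assms(1,3), of "-1"]]
  by simp

lemma linear_operator_zero:
  assumes "linear_operator T"
  shows "T 0 = Some 0"
proof -
  have "0 \<in> dom T"
    using assms complex_vector.subspace_0 unfolding linear_operator_def by blast
  then obtain a where "T 0 = Some a" by blast
  from linear_operator_diff[OF assms this this] show ?thesis by simp
qed

lemma linear_operatorI:
  assumes "T 0 = Some 0"
    and "\<And>x y a b. T x = Some a \<Longrightarrow> T y = Some b \<Longrightarrow> T (x + y) = Some (a + b)"
    and "\<And>c x a. T x = Some a \<Longrightarrow> T (c *\<^sub>C x) = Some (c *\<^sub>C a)"
  shows "linear_operator T"
  unfolding linear_operator_def complex_vector.subspace_def
proof (intro conjI ballI allI)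
  show "0 \<in> dom T" using assms(1) by blast
  fix x assume "x \<in> dom T"
  then obtain a where a: "T x = Some a" by blast
  show "c *\<^sub>C x \<in> dom T" "op_apply T (c *\<^sub>C x) = c *\<^sub>C op_apply T x" for c
    using assms(3)[OF a, of c] a by (auto simp: op_apply_def)
  fix y assume "y \<in> dom T"
  then obtain b where b: "T y = Some b" by blast
  show "x + y \<in> dom T" "op_apply T (x + y) = op_apply T x + op_apply T y"
    using assms(2)[OF a b] a b by (auto simp: op_apply_def)
qed

lemma subspace_null_space:
  assumes "linear_operator T"
  shows "complex_vector.subspace (null_space T)"
  unfolding complex_vector.subspace_def null_space_def
  using linear_operator_zero[OF assms] linear_operator_add[OF assms, of _ 0 _ 0]
    linear_operator_scaleC[OF assms, of _ 0] by simp

lemma closed_null_space: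
  assumes "closed (Map.graph T)"
  shows "closed (null_space T)"
proof -
  have "null_space T = (\<lambda>x. (x, 0)) -` Map.graph T"
    by (auto simp: null_space_def Map.graph_def)
  then show ?thesis
    using assms by (simp add: continuous_closed_vimage continuous_intros)
qed

lemma linear_operator_inj_on_orth_compl_null_space:
  assumes "linear_operator T" "T x = Some a" "T y = Some a"
    and "x \<in> orth_compl (null_space T)" "y \<in> orth_compl (null_space T)"
  shows "x = y"
proof -
  have "x - y \<in> null_space T"
    using linear_operator_diff[OF assms(1-3)] by (simp add: null_space_def)
  moreover have "x - y \<in> orth_compl (null_space T)"
    using complex_vector.subspace_diff[OF subspace_orth_compl] assms(4,5) by blast
  ultimately show ?thesis using mem_orth_compl_self by fastforce
qed

section \<open>The right inverse orthogonal to the null space is the Moore-Penrose inverse\<close>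

context
  fixes T :: "'a::complex_hilbert_space \<rightharpoonup> 'b::complex_hilbert_space" and f :: "'b \<Rightarrow> 'a"
  assumes T: "closed_densely_defined T" "ran T = UNIV"
    and f: "\<And>y. f y \<in> orth_compl (null_space T)" "\<And>y. T (f y) = Some y"
begin

private lemmas lin = closed_densely_definedD(1)[OF T(1)]

text \<open>Solutions orthogonal to the null space are unique. Linearity of \<open>f\<close>
  follows, since sums and multiples of such solutions are again such solutions.\<close>

lemma orth_right_inverse_eqI: "T x = Some y \<Longrightarrow> x \<in> orth_compl (null_space T) \<Longrightarrow> f y = x"
  using linear_operator_inj_on_orth_compl_null_space[OF lin f(2) _ f(1)] by blast

lemma orth_right_inverse_add: "f (x + y) = f x + f y"
  by (intro orth_right_inverse_eqI linear_operator_add lin f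
      complex_vector.subspace_add subspace_orth_compl)

lemma orth_right_inverse_scaleC: "f (c *\<^sub>C x) = c *\<^sub>C f x"
  by (intro orth_right_inverse_eqI linear_operator_scaleC lin f
      complex_vector.subspace_scale subspace_orth_compl)

text \<open>A pair \<open>(y, x)\<close> is in the graph of \<open>f\<close> exactly when
  \<open>(x, y)\<close> is in that of \<open>T\<close> and \<open>x\<close> is orthogonal to the
  null space: two closed conditions.\<close>

lemma closed_graph_orth_right_inverse: "closed (range (\<lambda>y. (y, f y)))"
proof -
  have "range (\<lambda>y. (y, f y))
    = prod.swap -` Map.graph T \<inter> snd -` orth_compl (null_space T)"
    using f orth_right_inverse_eqI by (auto simp: Map.graph_def)
  moreover have "closed (prod.swap -` Map.graph T :: ('b \<times> 'a) set)"
    using closed_densely_definedD(2)[OF T(1)]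
    by (intro continuous_closed_vimage) (simp_all add: continuous_intros prod.swap_def)
  moreover have "closed (snd -` orth_compl (null_space T) :: ('b \<times> 'a) set)"
    by (intro continuous_closed_vimage closed_orth_compl subspace_null_space lin)
      (simp add: continuous_intros)
  ultimately show ?thesis by (simp add: closed_Int)
qed

lemma bounded_clinear_orth_right_inverse: "bounded_clinear f"
proof -
  have "linear f"
    using orth_right_inverse_scaleC[of "complex_of_real _"]
    by (intro linearI) (simp_all add: orth_right_inverse_add scaleC_of_real)
  then have "bounded_linear f" using closed_graph_orth_right_inverse by (rule closed_graph)
  then show ?thesis by (simp add: bounded_clinear_iff orth_right_inverse_scaleC)
qed

lemma is_mp_inverse_orth_right_inverse: "is_mp_inverse T (\<lambda>y. Some (f y))"
  unfolding is_mp_inverse_def T(2)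
proof (intro conjI ballI)
  have f0: "f 0 = 0"
    using complex_vector.subspace_0[OF subspace_orth_compl]
    by (intro orth_right_inverse_eqI linear_operator_zero lin)
  have "Map.graph (\<lambda>y. Some (f y)) = range (\<lambda>y. (y, f y))"
    by (auto simp: Map.graph_def)
  moreover have "linear_operator (\<lambda>y. Some (f y))"
    by (rule linear_operatorI) (auto simp: f0 orth_right_inverse_add orth_right_inverse_scaleC)
  ultimately show "closed_densely_defined (\<lambda>y. Some (f y))"
    unfolding closed_densely_defined_def
    using closed_graph_orth_right_inverse by (simp add: dom_def)
  show "dom (\<lambda>y. Some (f y)) = {u + v |u v. u \<in> UNIV \<and> v \<in> orth_compl (UNIV::'b set)}"
    unfolding orth_compl_UNIV by (auto simp: dom_def)
  show "null_space (\<lambda>y. Some (f y)) = orth_compl UNIV"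
    unfolding orth_compl_UNIV null_space_def using f0 f(2) linear_operator_zero[OF lin]
    by (auto dest: sym) (metis option.inject)
next
  fix y :: 'b
  have "orth_proj (closure UNIV) y = y"
    by (rule orth_proj_eqI) (simp_all add: orth_compl_UNIV)
  then show "(T \<circ>\<^sub>m (\<lambda>y. Some (f y))) y = Some (orth_proj (closure UNIV) y)"
    using f(2) by simp
next
  fix x assume "x \<in> dom T"
  then obtain a where a: "T x = Some a" by blast
  have "x - f a \<in> null_space T"
    using linear_operator_diff[OF lin a f(2)] by (simp add: null_space_def)
  \<comment> \<open>\<open>x - f a\<close> lies in the null space, hence in its double complement,
    while \<open>f a\<close> lies in the complement.\<close>
  then have "orth_proj (orth_compl (null_space T)) x = f a"
    using subset_orth_compl_orth_compl f(1) by (intro orth_proj_eqI subspace_orth_compl) blast+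
  then show "((\<lambda>y. Some (f y)) \<circ>\<^sub>m T) x = Some (orth_proj (orth_compl (null_space T)) x)"
    using a by simp
qed

text \<open>The prescribed value of \<open>X\<close> after \<open>T\<close> determines
  \<open>X\<close> on the range of \<open>T\<close>, which is everything; evaluating at
  \<open>f y\<close> reads off \<open>X y\<close>.\<close>

lemma mp_inverse_eq_orth_right_inverse: "mp_inverse T = (\<lambda>y. Some (f y))"
  unfolding mp_inverse_def
proof (rule the_equality)
  show "is_mp_inverse T (\<lambda>y. Some (f y))" by (rule is_mp_inverse_orth_right_inverse)
  fix X assume X: "is_mp_inverse T X"
  show "X = (\<lambda>y. Some (f y))"
  proof
    fix y
    have "(X \<circ>\<^sub>m T) (f y) = ((\<lambda>y. Some (f y)) \<circ>\<^sub>m T) (f y)"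
      using X is_mp_inverse_orth_right_inverse f(2) unfolding is_mp_inverse_def
      by (metis domI)
    then show "X y = Some (f y)" using f(2) by simp
  qed
qed

end

text \<open>Removing from any solution of \<open>T x = y\<close> its component in the closed null
  space leaves a solution orthogonal to that space.\<close>

lemma orth_right_inverse_exists:
  assumes T: "closed_densely_defined T" "ran T = UNIV"
  shows "\<exists>f. \<forall>y. f y \<in> orth_compl (null_space T) \<and> T (f y) = Some y"
proof -
  note lin = closed_densely_definedD(1)[OF T(1)] and cl = closed_densely_definedD(2)[OF T(1)]
  have "\<exists>z. z \<in> orth_compl (null_space T) \<and> T z = Some y" for y
  proof -
    have "y \<in> ran T" using T(2) by simp
    then obtain x where x: "T x = Some y" by (auto simp: ran_def)
    obtain p where p: "p \<in> null_space T" "x - p \<in> orth_compl (null_space T)"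
      using orth_decomposition[OF subspace_null_space[OF lin] closed_null_space[OF cl]] by blast
    have "T (x - p) = Some (y - 0)"
      using p(1) x by (intro linear_operator_diff lin) (simp_all add: null_space_def)
    with p(2) show ?thesis by auto
  qed
  then show ?thesis by metis
qed


section \<open>Perturbation of the Moore-Penrose inverse\<close>

text \<open>The domain is that of \<open>T\<close>, and the graph is the preimage of the graph of
  \<open>T\<close> under the continuous shear \<open>(x, y - S x)\<close>.\<close>

lemma closed_densely_defined_add_operator:
  assumes T: "closed_densely_defined T" and S: "bounded_clinear S"
  shows "closed_densely_defined (add_operator S T)"
proof -
  have S': "bounded_linear S" and sc: "S (c *\<^sub>C x) = c *\<^sub>C S x" for c x
    using S by (simp_all add: bounded_clinear_iff)
  have lin: "linear_operator T" using T by (simp add: closed_densely_defined_def)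
  have "linear_operator (add_operator S T)"
    by (rule linear_operatorI)
      (auto simp: add_operator_def linear_operator_zero[OF lin] linear_operator_add[OF lin]
        linear_operator_scaleC[OF lin] linear_simps[OF S'] sc scaleC_add_right)
  moreover have "dom (add_operator S T) = dom T" by (auto simp: add_operator_def)
  moreover have "Map.graph (add_operator S T) = (\<lambda>(x, y). (x, y - S x)) -` Map.graph T"
    by (auto simp: Map.graph_def add_operator_def algebra_simps)
  moreover have "closed ((\<lambda>(x, y). (x, y - S x)) -` Map.graph T)"
    unfolding case_prod_unfold using T
    by (intro continuous_closed_vimage)
      (auto simp: closed_densely_defined_def intro!: continuous_intros bounded_linear.continuous[OF S'])
  ultimately show ?thesis using T by (simp add: closed_densely_defined_def)
qed

text \<open>If \<open>S x + T x = 0\<close>, then \<open>S x\<close> and \<open>T x\<close> have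
  equal norm, which with \<open>c < 1\<close> forces \<open>T x = 0\<close>. Conversely
  \<open>T x = 0\<close> forces \<open>S x = 0\<close>.\<close>

lemma null_space_add_operator:
  assumes "linear_operator T" "c < 1" "S 0 = 0"
    and le: "\<forall>x\<in>dom T. norm (S x) \<le> c * norm (op_apply T x)"
  shows "null_space (add_operator S T) = null_space T"
proof (intro equalityI subsetI)
  fix x assume "x \<in> null_space (add_operator S T)"
  then obtain a where a: "T x = Some a" "S x + a = 0"
    by (auto simp: null_space_def add_operator_def)
  then have "norm (S x) \<le> c * norm a" using le by (force simp: op_apply_def)
  moreover have "norm (S x) = norm a" using a(2) by (metis add_eq_0_iff norm_minus_cancel)
  ultimately have "(1 - c) * norm a \<le> 0" by (simp add: algebra_simps)
  then show "x \<in> null_space T" using \<open>c < 1\<close> a(1) by (simp add: mult_le_0_iff null_space_def)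
next
  fix x assume "x \<in> null_space T"
  then have x: "T x = Some 0" by (simp add: null_space_def)
  then have "norm (S x) \<le> 0" using le by (force simp: op_apply_def)
  with x show "x \<in> null_space (add_operator S T)" by (simp add: null_space_def add_operator_def)
qed

text \<open>Boundedness, bijectivity and closedness of the sum stand beside the estimates because
  \<open>onorm\<close>, \<open>inv\<close> and \<open>mp_inverse\<close> are total and carry their
  intended meaning only under such conditions.\<close>

theorem corollary5p3:
  fixes T :: "'a::complex_hilbert_space \<rightharpoonup> 'b::complex_hilbert_space"
    and S :: "'a \<Rightarrow> 'b"
    and lambda1 :: real
  assumes "infinite_dimensional TYPE('a)" and "infinite_dimensional TYPE('b)"
    and "closed_densely_defined T" and "ran T = UNIV"
    and "bounded_clinear S"
    and "lambda1 < 1"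
    and "\<forall>x\<in>dom T. norm (S x) \<le> lambda1 * norm (op_apply T x)"
  shows "everywhere_bounded (mp_inverse T) \<and>
    (let STd = S \<circ> op_apply (mp_inverse T) in
      (onorm STd < 1 \<and>
       bij (\<lambda>y. y + STd y) \<and>
       bounded_clinear (inv (\<lambda>y. y + STd y)) \<and>
       onorm (inv (\<lambda>y. y + STd y)) \<le> 1 / (1 - onorm STd)) \<and>
      (closed_densely_defined (add_operator S T) \<and>
       everywhere_bounded (mp_inverse (add_operator S T)) \<and>
       onorm (\<lambda>y. op_apply (mp_inverse (add_operator S T)) y - op_apply (mp_inverse T) y)
         \<le> (onorm (op_apply (mp_inverse T)))\<^sup>2 * onorm S / (1 - onorm STd)))"
proof -
  note T = assms(3,4)
  note lin = closed_densely_definedD(1)[OF T(1)]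
  obtain f where f: "\<And>y. f y \<in> orth_compl (null_space T)" "\<And>y. T (f y) = Some y"
    using orth_right_inverse_exists[OF T] by blast
  have mpT: "mp_inverse T = (\<lambda>y. Some (f y))"
    by (rule mp_inverse_eq_orth_right_inverse[OF T f])
  have f_bcl: "bounded_clinear f" by (rule bounded_clinear_orth_right_inverse[OF T f])
  then have f_bl: "bounded_linear f" by (simp add: bounded_clinear_iff)
  have S_bl: "bounded_linear S" using assms(5) by (simp add: bounded_clinear_iff)

  \<comment> \<open>The inverse of the perturbed identity\<close>
  define B where "B = S \<circ> f"
  have B: "bounded_clinear B"
    unfolding B_def by (rule bounded_clinear_compose[OF assms(5) f_bcl])
  then have B_bl: "bounded_linear B" by (simp add: bounded_clinear_iff)
  \<comment> \<open>\<open>lambda1\<close> may be negative, whereas a bound on \<open>onorm\<close>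
    is taken from a nonnegative constant.\<close>
  have "norm (B y) \<le> max 0 lambda1 * norm y" for y
  proof -
    have "norm (B y) \<le> lambda1 * norm y"
      using assms(7) f(2)[of y] by (force simp: B_def op_apply_def)
    also have "\<dots> \<le> max 0 lambda1 * norm y" by (intro mult_right_mono) auto
    finally show ?thesis .
  qed
  then have "onorm B \<le> max 0 lambda1" by (intro onorm_bound) auto
  then have B1: "onorm B < 1" using assms(6) by simp
  define R where "R = inv (\<lambda>y. y + B y)"
  have bij: "bij (\<lambda>y. y + B y)" by (rule bounded_linear_perturbation_identity(1)[OF B_bl B1])
  have R: "bounded_clinear R"
    unfolding R_def by (rule bounded_clinear_inv_perturbation_identity[OF B B1])
  have norm_R: "norm (R y) \<le> 1 / (1 - onorm B) * norm y" for y
    unfolding R_def by (rule bounded_linear_perturbation_identity(2)[OF B_bl B1])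
  have onorm_R: "onorm R \<le> 1 / (1 - onorm B)"
    by (rule onorm_bound[OF _ norm_R]) (use B1 in simp)
  have R_eq: "R y + B (R y) = y" for y
    unfolding R_def by (rule surj_f_inv_f[OF bij_is_surj[OF bij]])

  \<comment> \<open>The Moore-Penrose inverse of the sum\<close>
  let ?A = "add_operator S T"
  have A: "closed_densely_defined ?A"
    by (rule closed_densely_defined_add_operator[OF T(1) assms(5)])
  \<comment> \<open>The null spaces agree, and applying \<open>?A\<close> to \<open>f (R y)\<close>
    gives \<open>B (R y) + R y = y\<close>. So \<open>f\<close> after \<open>R\<close> is the
    orthogonal right inverse of \<open>?A\<close>.\<close>
  have fR: "f (R y) \<in> orth_compl (null_space ?A)" "?A (f (R y)) = Some y" for y
    using f R_eq[of y] null_space_add_operator[OF lin assms(6) linear_simps(3)[OF S_bl] assms(7)]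
    by (simp_all add: add_operator_def B_def add.commute)
  have A_ran: "ran ?A = UNIV" using fR(2) by (auto simp: ran_def)
  have mpA: "mp_inverse ?A = (\<lambda>y. Some (f (R y)))"
    by (rule mp_inverse_eq_orth_right_inverse[OF A A_ran fR])
  have fR_bcl: "bounded_clinear (\<lambda>y. f (R y))"
    by (rule bounded_clinear_orth_right_inverse[OF A A_ran fR])

  have "norm (f (R y) - f y) \<le> (onorm f)\<^sup>2 * onorm S / (1 - onorm B) * norm y" for y
  proof -
    \<comment> \<open>The difference of the two inverses becomes \<open>- f (S (f (R y)))\<close>:
      two factors \<open>onorm f\<close>, one \<open>onorm S\<close>, and the bound on
      \<open>R\<close>.\<close>
    have "R y - y = - B (R y)" using R_eq[of y] by (simp add: algebra_simps)
    then have "f (R y) - f y = f (- B (R y))" by (simp add: linear_simps(2)[OF f_bl, symmetric])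
    also have "norm \<dots> \<le> onorm f * norm (S (f (R y)))"
      using onorm[OF f_bl, of "- B (R y)"] by (simp add: B_def)
    also have "\<dots> \<le> onorm f * (onorm S * (onorm f * (1 / (1 - onorm B) * norm y)))"
      by (intro mult_left_mono order_trans[OF onorm[OF S_bl]] order_trans[OF onorm[OF f_bl]]
          norm_R onorm_pos_le f_bl S_bl)
    finally show ?thesis by (simp add: power2_eq_square mult_ac)
  qed
  then have "onorm (\<lambda>y. f (R y) - f y) \<le> (onorm f)\<^sup>2 * onorm S / (1 - onorm B)"
    using B1 onorm_pos_le[OF S_bl] by (intro onorm_bound) simp_all
  moreover have op_apply_Some: "op_apply (\<lambda>y. Some (g y)) = g" for g :: "'b \<Rightarrow> 'a"
    by (simp add: fun_eq_iff op_apply_def)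
  ultimately show ?thesis
    using f_bcl fR_bcl B1 bij R onorm_R A
    unfolding Let_def mpT mpA everywhere_bounded_def op_apply_Some B_def R_def
    by (simp add: dom_def)
qed

end
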